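(* Let $s\ge1$ be an integer and $\beta>0$. Let $\mathbf{L}^{F_\beta}$ be the $2^s\times2^s$ real matrix with rows and columns indexed by $\{0,1\}^s$ and entries $\ell^{F_\beta}_{\mathbf{y},\hat{\mathbf{y}}}=1-F_\beta(\mathbf{y},\hat{\mathbf{y}})$ for $\mathbf{y},\hat{\mathbf{y}}\in\{0,1\}^s$. Let $\mathbf{L}^{F_\beta}-1$ denote the matrix obtained by subtracting $1$ from every entry of $\mathbf{L}^{F_\beta}$. Then $$\operatorname{rank}(\mathbf{L}^{F_\beta}-1)\le s^2+1.$$
   Context: For $\mathbf{y},\hat{\mathbf{y}}\in\{0,1\}^s$, the $F_\beta$-measure is $$F_\beta(\mathbf{y},\hat{\mathbf{y}})=\frac{(1+\beta^2)\sum_{j=1}^s y_j\hat y_j}{\beta^2\|\mathbf{y}\|_1+\|\hat{\mathbf{y}}\|_1},\qquad \|\mathbf{y}\|_1=\sum_{j=1}^s y_j,$$ with the convention $\frac00=1$, so that $F_\beta(\mathbf{0},\mathbf{0})=1$. *)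

theory Defs
  imports "HOL-Analysis.Analysis"
begin

text \<open>The set \<open>{0,1}\<^sup>s\<close> is the finite type \<open>bool ^ 's\<close> with \<open>s = CARD('s)\<close>; \<open>of_bool\<close> turns
  its coordinates into the real numbers 0 and 1.\<close>

definition l1 :: "bool ^ 's::finite \<Rightarrow> real" where
  "l1 y = (\<Sum>j\<in>UNIV. of_bool (y $ j))"

definition ratio :: "real \<Rightarrow> real \<Rightarrow> real" where
  "ratio a b = (if a = 0 \<and> b = 0 then 1 else a / b)"
  \<comment> \<open>division with the convention \<open>0 / 0 = 1\<close> (in the library, \<open>0 / 0 = 0\<close>)\<close>

definition F_measure :: "real \<Rightarrow> bool ^ 's::finite \<Rightarrow> bool ^ 's \<Rightarrow> real" where
  "F_measure \<beta> y y' =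
     ratio ((1 + \<beta>\<^sup>2) * (\<Sum>j\<in>UNIV. of_bool (y $ j) * of_bool (y' $ j)))
           (\<beta>\<^sup>2 * l1 y + l1 y')"

definition F_loss_matrix :: "real \<Rightarrow> real ^ (bool ^ 's::finite) ^ (bool ^ 's)" where
  "F_loss_matrix \<beta> = (\<chi> y y'. 1 - F_measure \<beta> y y')"

text \<open>\<open>mat 1\<close> would be the identity matrix; here the scalar \<open>c\<close> is subtracted from every entry.\<close>

definition minus_entrywise :: "real ^ 'n ^ 'm \<Rightarrow> real \<Rightarrow> real ^ 'n ^ 'm" where
  "minus_entrywise A c = (\<chi> i j. A $ i $ j - c)"

end

theory Submission
  imports Defs
begin

text \<open>Fixing the value \<open>k = \<parallel>y\<parallel>\<^sub>1 \<ge> 1\<close> makes the denominator independent of the rest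
  of \<open>y\<close>, so the row of \<open>y\<close> is a linear combination of the \<open>s\<close> vectors
  \<open>y' \<mapsto> y'\<^sub>j / (\<beta>\<^sup>2 k + \<parallel>y'\<parallel>\<^sub>1)\<close>. As \<open>k\<close> ranges over \<open>{1..s}\<close>, these are at most \<open>s\<^sup>2\<close> vectors;
  the row of \<open>y = 0\<close> contributes the one further dimension.\<close>

lemma l1_eq_card: "l1 y = real (card {j. y $ j})"
  by (simp add: l1_def of_bool_def sum.If_cases)

text \<open>Rank is the dimension of the row space, so the bound reduces to exhibiting a finite
  spanning family; linear independence of \<open>B\<close> never has to be checked.\<close>

lemma rank_le_if_rows_in_span:
  fixes A :: "real ^ 'n ^ 'm"
  assumes "finite B" and "\<And>i. row i A \<in> span B"
  shows "rank A \<le> card B"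
proof -
  have "rows A \<subseteq> span B"
    using assms(2) by (auto simp: rows_def)
  then show ?thesis
    using assms(1) by (simp add: row_rank_def dim_le_card)
qed

definition basis_row :: "real \<Rightarrow> 's::finite \<Rightarrow> nat \<Rightarrow> real ^ (bool ^ 's)" where
  "basis_row \<beta> j k = (\<chi> y'. of_bool (y' $ j) / (\<beta>\<^sup>2 * real k + l1 y'))"

lemma row_eq_F_measure:
  "row y (minus_entrywise (F_loss_matrix \<beta>) 1) $ y' = - F_measure \<beta> y y'"
  by (simp add: row_def minus_entrywise_def F_loss_matrix_def)

text \<open>The numerator vanishes for every \<open>y'\<close>, so an entry of
  \<open>F_measure\<close> can be nonzero only through the convention 0/0 = 1, which applies exactly
  when \<open>y'\<close> is zero too.\<close>

lemma row_zero:
  fixes y :: "bool ^ 's::finite"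
  assumes "card {j. y $ j} = 0"
  shows "row y (minus_entrywise (F_loss_matrix \<beta>) 1) = - axis (\<chi> j. False) 1"
proof -
  have l1_y': "l1 y' = 0 \<longleftrightarrow> y' = (\<chi> j. False)" for y' :: "bool ^ 's"
    by (auto simp: l1_eq_card vec_eq_iff)
  have "l1 y = 0"
    using assms by (simp add: l1_eq_card)
  moreover have "(\<Sum>j\<in>UNIV. of_bool (y $ j) * of_bool (y' $ j)) = (0 :: real)" for y' :: "bool ^ 's"
    using assms by (intro sum.neutral) auto
  ultimately have "F_measure \<beta> y y' = (if y' = (\<chi> j. False) then 1 else 0)" for y'
    unfolding F_measure_def ratio_def l1_y'[symmetric] by simp
  then show ?thesis
    by (simp add: vec_eq_iff[where x = "row _ _"] row_eq_F_measure axis_def)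
qed

text \<open>The denominator depends on \<open>y\<close> only through its support size, so the sum
  over \<open>j\<close> splits off with coefficients independent of \<open>y'\<close>.\<close>

lemma row_nonzero:
  fixes y :: "bool ^ 's::finite"
  assumes "\<beta> > 0" and "card {j. y $ j} > 0"
  shows "row y (minus_entrywise (F_loss_matrix \<beta>) 1) =
    (\<Sum>j\<in>UNIV. (- (1 + \<beta>\<^sup>2) * of_bool (y $ j)) *\<^sub>R basis_row \<beta> j (card {j. y $ j}))"
    (is "_ = ?R")
proof (subst vec_eq_iff, intro allI)
  fix y' :: "bool ^ 's"
  let ?d = "\<beta>\<^sup>2 * l1 y + l1 y'"
  \<comment> \<open>A nonempty support and \<open>\<beta> > 0\<close> rule out the 0/0 case, so
    \<open>ratio\<close> is ordinary division here.\<close>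
  have "?d > 0"
    using assms by (simp add: l1_eq_card add_pos_nonneg)
  then have "- F_measure \<beta> y y' =
      - ((1 + \<beta>\<^sup>2) * (\<Sum>j\<in>UNIV. of_bool (y $ j) * of_bool (y' $ j)) / ?d)"
    unfolding F_measure_def ratio_def by simp
  also have "\<dots> = (\<Sum>j\<in>UNIV. - (1 + \<beta>\<^sup>2) * of_bool (y $ j) * (of_bool (y' $ j) / ?d))"
    unfolding sum_distrib_left sum_divide_distrib sum_negf[symmetric]
    by (intro sum.cong refl) (simp add: add_divide_distrib diff_divide_distrib)
  also have "\<dots> = ?R $ y'"
    unfolding sum_component vector_scaleR_component basis_row_def vec_lambda_beta
      l1_eq_card[of y] real_scaleR_def ..
  finally show "row y (minus_entrywise (F_loss_matrix \<beta>) 1) $ y' = ?R $ y'"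
    unfolding row_eq_F_measure .
qed

theorem proposition3:
  fixes \<beta> :: real
  assumes "\<beta> > 0"
  shows "rank (minus_entrywise (F_loss_matrix \<beta> :: real ^ (bool ^ 's::finite) ^ (bool ^ 's)) 1)
           \<le> CARD('s)\<^sup>2 + 1"
proof -
  \<comment> \<open>Support size 0 is left out: it would add up to s further vectors, whereas the
    single axis vector in \<open>B\<close> covers the zero row.\<close>
  define V :: "(real ^ (bool ^ 's)) set"
    where "V = (\<lambda>(j, k). basis_row \<beta> j k) ` (UNIV \<times> {1..CARD('s)})"
  define B where "B = insert (axis (\<chi> j. False) 1) V"
  have "card V \<le> card ((UNIV :: 's set) \<times> {1..CARD('s)})"
    unfolding V_def by (rule card_image_le) simp
  then have card_V: "card V \<le> CARD('s)\<^sup>2"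
    by (simp add: card_cartesian_product power2_eq_square)
  have "finite B"
    by (simp add: B_def V_def)
  moreover have "row y (minus_entrywise (F_loss_matrix \<beta>) 1) \<in> span B" for y :: "bool ^ 's"
  proof (cases "card {j. y $ j} = 0")
    case True
    then show ?thesis
      unfolding row_zero[OF True] by (intro span_neg span_base) (simp add: B_def)
  next
    case False
    then have card_pos: "card {j. y $ j} > 0"
      by blast
    have "card {j. y $ j} \<le> CARD('s)"
      by (rule card_mono) auto
    then have "basis_row \<beta> j (card {j. y $ j}) \<in> B" for j
      using card_pos unfolding B_def V_def
      by (intro insertI2 image_eqI[where x = "(j, card {j. y $ j})"])
        (simp_all add: Suc_le_eq)
    then show ?thesis
      unfolding row_nonzero[OF assms card_pos] by (intro span_sum span_scale span_base)
  qed
  ultimately have "rank (minus_entrywise (F_loss_matrix \<beta> :: real ^ (bool ^ 's) ^ (bool ^ 's)) 1)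
      \<le> card B"
    by (rule rank_le_if_rows_in_span)
  also have "\<dots> \<le> CARD('s)\<^sup>2 + 1"
    using card_V by (simp add: B_def card_insert_if V_def)
  finally show ?thesis .
qed

end
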